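(* Let $p$ be a positive integer and let $m$ and $r$ be nonnegative integers with $m+p\ge r+1$. Then $$\sum_{\substack{\boldsymbol{\alpha}\in\mathbb{N}^p\\ |\boldsymbol{\alpha}|=p+m}}\ \sum_{1\le k_1<k_2<\cdots<k_p}(k_1+r)^{-\alpha_1}\cdots(k_{p-1}+r)^{-\alpha_{p-1}}(k_p+r)^{-\alpha_p-1}$$ $$=\frac{1}{r!}\sum_{\ell=1}^{\infty} \frac{\ell(\ell+1)\cdots(\ell+r-1)}{(\ell+r)^{m+1}}\sum_{j=0}^r (-1)^j \binom{r}{j}(\ell+j)^{-p}.$$
   Context: $\mathbb{N}$ denotes the set of positive integers. For a tuple $\boldsymbol{\alpha}=(\alpha_1,\ldots,\alpha_p)$ of positive integers, $|\boldsymbol{\alpha}|=\alpha_1+\cdots+\alpha_p$. The sum over $1\le k_1<\cdots<k_p$ runs over all strictly increasing $p$-tuples of positive integers. The product $\ell(\ell+1)\cdots(\ell+r-1)$ has $r$ factors and equals $1$ when $r=0$. *)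

theory Defs
  imports "HOL-Analysis.Analysis"
begin

text \<open>
  A \<open>p\<close>-tuple is a list of length \<open>p\<close>; its entries with mathematical indices \<open>1, \<dots>, p\<close>
  are \<open>xs ! 0, \<dots>, xs ! (p - 1)\<close>.
\<close>

definition weighted_tuples :: "nat \<Rightarrow> nat \<Rightarrow> nat list set" where
  "weighted_tuples p n = {\<alpha>. length \<alpha> = p \<and> (\<forall>a\<in>set \<alpha>. 1 \<le> a) \<and> sum_list \<alpha> = n}"

definition increasing_tuples :: "nat \<Rightarrow> nat list set" where
  "increasing_tuples p = {k. length k = p \<and> (\<forall>x\<in>set k. 1 \<le> x) \<and> sorted_wrt (<) k}"

lemma finite_weighted_tuples: "finite (weighted_tuples p n)"
proof (rule finite_subset)
  show "weighted_tuples p n \<subseteq> {xs. set xs \<subseteq> {..n} \<and> length xs = p}"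
    by (auto simp: weighted_tuples_def intro: member_le_sum_list)
  show "finite {xs. set xs \<subseteq> {..n} \<and> length xs = p}"
    by (rule finite_lists_length_eq) simp
qed

definition shifted_mzv_term :: "nat \<Rightarrow> nat \<Rightarrow> nat list \<Rightarrow> nat list \<Rightarrow> real" where
  "shifted_mzv_term p r \<alpha> k =
     (\<Prod>i<p - 1. real (k ! i + r) powi (- int (\<alpha> ! i))) *
     real (k ! (p - 1) + r) powi (- int (\<alpha> ! (p - 1)) - 1)"

text \<open>\<open>pochhammer x r\<close> is the rising factorial \<open>x (x + 1) \<cdots> (x + r - 1)\<close>.\<close>

definition rhs_term :: "nat \<Rightarrow> nat \<Rightarrow> nat \<Rightarrow> nat \<Rightarrow> real" where
  "rhs_term p m r l =
     pochhammer (real l) r / real (l + r) ^ (m + 1) *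
     (\<Sum>j=0..r. (- 1) ^ j * real (r choose j) * real (l + j) powi (- int p))"

end

theory Submission
  imports Defs "HOL-Complex_Analysis.Cauchy_Integral_Formula"
begin

text \<open>
  Take the generating function in \<open>y\<close>, \<open>0 < y < 1\<close>, with \<open>y\<^sup>p\<^sup>-\<^sup>1\<close> marking the depth \<open>p\<close>.
  The part of the left-hand side with fixed last entry \<open>k\<^sub>p = n + 1\<close> then becomes the finite convolution
  \<open>\<Sum>l\<le>n. (1 - y)\<^sub>l / l! * (y)\<^sub>n\<^sub>-\<^sub>l / (n - l)! / (l + 1 + r)\<^sup>m\<^sup>+\<^sup>1\<close> (the partial fraction expansion of the
  generating function in \<open>m\<close>), because both satisfy the same recursion in \<open>n\<close> and \<open>m\<close>. All its terms
  are positive, so the sum over \<open>n\<close> may be rearranged by \<open>l\<close>; the inner series is the Beta series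
  \<open>\<Sum>b. (y)\<^sub>b / (b! (b + q + 1)) = q! / (1 - y)\<^sub>q\<^sub>+\<^sub>1\<close>. What remains is
  \<open>\<Sum>l\<ge>1. (l)\<^sub>r / ((l + r)\<^sup>m\<^sup>+\<^sup>1 (l - y)\<^sub>r\<^sub>+\<^sub>1)\<close>, and expanding \<open>1 / (l - y)\<^sub>r\<^sub>+\<^sub>1\<close> in partial fractions
  and powers of \<open>y\<close>, again with nonnegative coefficients, gives the right-hand side.
\<close>

subsection \<open>Series with nonnegative terms and power series\<close>

lemma has_sum_sum:
  fixes f :: "'a \<Rightarrow> 'b \<Rightarrow> 'c :: topological_comm_monoid_add"
  assumes "finite I" "\<And>i. i \<in> I \<Longrightarrow> (f i has_sum S i) A"
  shows "((\<lambda>x. \<Sum>i\<in>I. f i x) has_sum (\<Sum>i\<in>I. S i)) A"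
  using assms by (induction I rule: finite_induct) (auto intro: has_sum_add)

text \<open>Tonelli: nonnegative terms with summable row sums are summable on the product, so
  columns may be summed first.\<close>

lemma has_sum_swap_nonneg:
  fixes f :: "'a \<Rightarrow> 'b \<Rightarrow> real"
  assumes nonneg: "\<And>x y. 0 \<le> f x y"
    and row: "\<And>x. x \<in> A \<Longrightarrow> (f x has_sum g x) B"
    and total: "(g has_sum S) A"
  shows "\<And>y. y \<in> B \<Longrightarrow> (\<lambda>x. f x y) summable_on A"
    and "((\<lambda>y. \<Sum>\<^sub>\<infinity>x\<in>A. f x y) has_sum S) B"
proof -
  have summ: "(\<lambda>(x, y). f x y) summable_on A \<times> B"
    by (rule summable_on_SigmaI[where g = g])
      (use row total nonneg in \<open>auto simp: has_sum_imp_summable\<close>)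
  have "((\<lambda>(x, y). f x y) has_sum S) (A \<times> B)"
    by (rule has_sum_SigmaI[where g = g]) (use row total summ in auto)
  then have sw: "((\<lambda>(y, x). f x y) has_sum S) (B \<times> A)"
    by (subst (asm) has_sum_swap) simp
  show col: "(\<lambda>x. f x y) summable_on A" if "y \<in> B" for y
    using summable_on_SigmaD1[OF has_sum_imp_summable[OF sw] that] .
  show "((\<lambda>y. \<Sum>\<^sub>\<infinity>x\<in>A. f x y) has_sum S) B"
    by (rule has_sum_SigmaD[OF sw]) (use col in simp)
qed

text \<open>Zeros of a nonzero power series are isolated, whereas the difference of the two series
  vanishes on all of \<open>(0, 1)\<close>.\<close>

lemma powser_unique_right:
  fixes a b :: "nat \<Rightarrow> real"
  assumes "\<And>y. 0 < y \<Longrightarrow> y < 1 \<Longrightarrow> (\<lambda>n. y ^ n * a n) sums s y"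
    and "\<And>y. 0 < y \<Longrightarrow> y < 1 \<Longrightarrow> (\<lambda>n. y ^ n * b n) sums s y"
  shows "a = b"
proof (rule ccontr)
  assume "a \<noteq> b"
  then obtain k where k: "a k \<noteq> b k" by auto
  \<comment> \<open>The difference is multiplied by \<open>y\<close>, which forces
    \<open>f 0 = 0\<close>, as the theorem on isolated zeros requires.\<close>
  define e where "e n = (case n of 0 \<Rightarrow> 0 | Suc i \<Rightarrow> a i - b i)" for n
  define f where "f x = (\<Sum>n. e n * x ^ n)" for x
  have e0: "(\<lambda>n. e n * y ^ n) sums 0" if y: "0 < y" "y < 1" for y
  proof -
    have "(\<lambda>n. y * (y ^ n * a n - y ^ n * b n)) sums (y * (s y - s y))"
      by (intro sums_mult sums_diff assms y)
    then have "(\<lambda>n. e (Suc n) * y ^ Suc n) sums 0" by (simp add: e_def algebra_simps)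
    from sums_Suc[OF this] show ?thesis by (simp add: e_def)
  qed
  \<comment> \<open>Convergence at the single point \<open>1 / 2\<close> extends to a full disc,
    negative arguments included.\<close>
  have sums: "(\<lambda>n. e n * x ^ n) sums f x" if "norm x < 1 / 2" for x
  proof -
    have "summable (\<lambda>n. e n * (1 / 2) ^ n)" by (rule sums_summable, rule e0) simp_all
    then have "summable (\<lambda>n. e n * x ^ n)" by (rule powser_inside) (use that in simp)
    then show ?thesis unfolding f_def by (rule summable_sums)
  qed
  have f_pos: "f x = 0" if "0 < x" "x < 1" for x
    using e0[OF that] by (simp add: f_def sums_iff)
  have "f 0 = 0" using sums_unique[OF powser_sums_zero[of e]] by (simp add: f_def e_def)
  moreover have "e (Suc k) \<noteq> 0" using k by (simp add: e_def)
  ultimately obtain t where t: "0 < t" "\<And>z. z \<in> cball 0 t - {0} \<Longrightarrow> f z \<noteq> 0"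
    using powser_0_nonzero[of "1 / 2" 0 e f "Suc k"] sums by auto
  have "f (min t (1 / 2)) \<noteq> 0" by (rule t(2)) (use t(1) in auto)
  moreover have "f (min t (1 / 2)) = 0" by (rule f_pos) (use t(1) in auto)
  ultimately show False by contradiction
qed

subsection \<open>Recursion on the last entry\<close>

text \<open>Here \<open>m\<close> is the excess of the weight over the depth: \<open>tuple_sum\<close> is the complete homogeneous symmetric
  polynomial of degree \<open>m\<close> in the \<open>1 / (k\<^sub>i + r)\<close>, times their product.\<close>

definition tuple_sum :: "nat \<Rightarrow> nat list \<Rightarrow> nat \<Rightarrow> real" where
  "tuple_sum r ks m =
     (\<Sum>\<alpha>\<in>weighted_tuples (length ks) (length ks + m).
        \<Prod>i<length ks. inverse (real (ks ! i + r) ^ (\<alpha> ! i)))"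

definition bounded_tuples :: "nat \<Rightarrow> nat \<Rightarrow> nat list set" where
  "bounded_tuples p N = {k \<in> increasing_tuples p. \<forall>x\<in>set k. x < N}"

text \<open>The entries of the tuples below are bounded by \<open>N\<close> in \<open>head_sum\<close>, while in \<open>last_sum\<close> a last entry \<open>N\<close>
  is appended, so that \<open>last_sum r p\<close> belongs to depth \<open>p + 1\<close>.\<close>

definition head_sum :: "nat \<Rightarrow> nat \<Rightarrow> nat \<Rightarrow> nat \<Rightarrow> real" where
  "head_sum r p m N = (\<Sum>ks\<in>bounded_tuples p N. tuple_sum r ks m)"

definition last_sum :: "nat \<Rightarrow> nat \<Rightarrow> nat \<Rightarrow> nat \<Rightarrow> real" where
  "last_sum r p m N = (\<Sum>ks\<in>bounded_tuples p N. tuple_sum r (ks @ [N]) m)"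

lemma tuple_sum_nonneg: "0 \<le> tuple_sum r ks m"
  unfolding tuple_sum_def by (intro sum_nonneg prod_nonneg) auto

lemma last_sum_nonneg: "0 \<le> last_sum r p m N"
  unfolding last_sum_def by (intro sum_nonneg tuple_sum_nonneg)

lemma tuple_sum_Nil: "tuple_sum r [] m = (if m = 0 then 1 else 0)"
proof -
  have "weighted_tuples 0 m = (if m = 0 then {[]} else {})"
    by (auto simp: weighted_tuples_def)
  then show ?thesis by (simp add: tuple_sum_def)
qed

lemma sum_list_ge_length: "\<forall>a\<in>set \<alpha>. 1 \<le> a \<Longrightarrow> length \<alpha> \<le> sum_list (\<alpha> :: nat list)"
  by (induction \<alpha>) auto

text \<open>Split off the last exponent \<open>Suc a\<close>; the excess left for the other
  exponents is \<open>m - a\<close>.\<close>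

lemma tuple_sum_snoc:
  "tuple_sum r (ks @ [N]) m =
     (\<Sum>a\<le>m. inverse (real (N + r) ^ Suc a) * tuple_sum r ks (m - a))"
proof -
  let ?p = "length ks"
  let ?g = "\<lambda>\<alpha>. \<Prod>i<?p. inverse (real (ks ! i + r) ^ (\<alpha> ! i))"
  have "tuple_sum r (ks @ [N]) m =
      (\<Sum>\<alpha>\<in>weighted_tuples (Suc ?p) (Suc ?p + m).
         ?g \<alpha> * inverse (real (N + r) ^ (\<alpha> ! ?p)))"
    unfolding tuple_sum_def by (simp add: nth_append)
  also have "\<dots> = (\<Sum>\<alpha>\<in>weighted_tuples (Suc ?p) (Suc ?p + m).
         inverse (real (N + r) ^ (\<alpha> ! ?p)) * ?g \<alpha>)"
    by (simp only: mult.commute)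
  also have "\<dots> = (\<Sum>(a, \<beta>)\<in>Sigma {..m} (\<lambda>a. weighted_tuples ?p (?p + (m - a))).
         inverse (real (N + r) ^ Suc a) * ?g \<beta>)"
  proof (rule sum.reindex_bij_witness[where
        i = "\<lambda>(a, \<beta>). \<beta> @ [Suc a]" and j = "\<lambda>\<alpha>. (last \<alpha> - 1, butlast \<alpha>)"], goal_cases)
    case (1 \<alpha>)
    then show ?case
      by (cases \<alpha> rule: rev_cases) (auto simp: weighted_tuples_def)
  next
    case (2 \<alpha>)
    then show ?case
      \<comment> \<open>The other exponents are at least 1 each, so the last one is at most
        \<open>m + 1\<close>.\<close>
      using sum_list_ge_length[of "butlast \<alpha>"]
      by (cases \<alpha> rule: rev_cases) (auto simp: weighted_tuples_def)
  next
    case (3 x)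
    then show ?case by auto
  next
    case (4 x)
    then show ?case by (auto simp: weighted_tuples_def)
  next
    case (5 \<alpha>)
    then obtain \<beta> a where "\<alpha> = \<beta> @ [Suc a]" "length \<beta> = ?p"
      by (cases \<alpha> rule: rev_cases; cases "last \<alpha>") (auto simp: weighted_tuples_def)
    then show ?case by (simp add: nth_append)
  qed
  also have "\<dots> = (\<Sum>a\<le>m. inverse (real (N + r) ^ Suc a) * tuple_sum r ks (m - a))"
    unfolding tuple_sum_def sum_distrib_left
    by (rule sum.Sigma[symmetric]) (auto simp: finite_weighted_tuples)
  finally show ?thesis .
qed

text \<open>In terms of generating functions in \<open>m\<close>: appending \<open>N\<close> divides by \<open>N + r - x\<close>.\<close>

lemma tuple_sum_snoc_mult:
  assumes "N > 0"
  shows "real (N + r) * tuple_sum r (ks @ [N]) m =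
    (if m = 0 then 0 else tuple_sum r (ks @ [N]) (m - 1)) + tuple_sum r ks m"
proof (cases m)
  case 0
  then show ?thesis using assms by (simp add: tuple_sum_snoc)
next
  case (Suc m')
  define x where "x = real (N + r)"
  have "x \<noteq> 0" using assms by (simp add: x_def)
  then have "x * (inverse (x ^ Suc a) * c) = inverse (x ^ a) * c" for a c
    by simp
  then have "x * tuple_sum r (ks @ [N]) m = (\<Sum>a\<le>m. inverse (x ^ a) * tuple_sum r ks (m - a))"
    unfolding tuple_sum_snoc x_def[symmetric] sum_distrib_left by (intro sum.cong) auto
  \<comment> \<open>The summand \<open>a = 0\<close> gives the first term; in the others the index
    drops by one.\<close>
  also have "\<dots> = tuple_sum r ks m + tuple_sum r (ks @ [N]) m'"
    unfolding tuple_sum_snoc x_def[symmetric] Suc sum.atMost_Suc_shift by simp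
  finally show ?thesis by (simp add: x_def Suc)
qed

lemma finite_bounded_tuples: "finite (bounded_tuples p N)"
proof (rule finite_subset)
  show "bounded_tuples p N \<subseteq> {xs. set xs \<subseteq> {..<N} \<and> length xs = p}"
    by (auto simp: bounded_tuples_def increasing_tuples_def)
qed (simp add: finite_lists_length_eq)

lemma bounded_tuples_0: "bounded_tuples 0 N = {[]}"
  by (auto simp: bounded_tuples_def increasing_tuples_def)

lemma length_bounded_tuples: "ks \<in> bounded_tuples p N \<Longrightarrow> length ks = p"
  by (simp add: bounded_tuples_def increasing_tuples_def)

lemma snoc_mem_increasing_tuples:
  "ks @ [M] \<in> increasing_tuples (Suc p) \<longleftrightarrow> 1 \<le> M \<and> ks \<in> bounded_tuples p M"
  by (auto simp: bounded_tuples_def increasing_tuples_def sorted_wrt_append)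

lemma increasing_tuples_Suc_last_butlast:
  assumes "k \<in> increasing_tuples (Suc p)"
  shows "butlast k @ [last k] = k" "1 \<le> last k" "butlast k \<in> bounded_tuples p (last k)"
proof -
  from assms have "k \<noteq> []" by (auto simp: increasing_tuples_def)
  then show *: "butlast k @ [last k] = k" by simp
  show "1 \<le> last k" "butlast k \<in> bounded_tuples p (last k)"
    using assms snoc_mem_increasing_tuples[of "butlast k" "last k" p] unfolding * by auto
qed

lemma head_sum_0: "head_sum r 0 m N = (if m = 0 then 1 else 0)"
  by (simp add: head_sum_def bounded_tuples_0 tuple_sum_Nil)

text \<open>Sort the tuples by their largest entry \<open>Suc k\<close>.\<close>

lemma head_sum_Suc: "head_sum r (Suc p) m (Suc n) = (\<Sum>k<n. last_sum r p m (Suc k))"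
proof -
  have "head_sum r (Suc p) m (Suc n) =
      (\<Sum>(k, ks)\<in>Sigma {..<n} (\<lambda>k. bounded_tuples p (Suc k)). tuple_sum r (ks @ [Suc k]) m)"
    unfolding head_sum_def
  proof (rule sum.reindex_bij_witness[where
        i = "\<lambda>(k, ks). ks @ [Suc k]" and j = "\<lambda>ks. (last ks - 1, butlast ks)"], goal_cases)
    case (1 ks)
    then show ?case
      using increasing_tuples_Suc_last_butlast[of ks p] by (simp add: bounded_tuples_def)
  next
    case (2 ks)
    then have *: "ks \<in> increasing_tuples (Suc p)" and "\<forall>x\<in>set ks. x < Suc n"
      by (auto simp: bounded_tuples_def)
    moreover from this have "last ks \<in> set ks"
      by (intro last_in_set) (auto simp: increasing_tuples_def)
    ultimately have "last ks < Suc n" by blast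
    then show ?case
      using increasing_tuples_Suc_last_butlast[OF *] by auto
  next
    case (3 x)
    then show ?case by auto
  next
    case (4 x)
    then obtain k ks where x: "x = (k, ks)" "k < n" "ks \<in> bounded_tuples p (Suc k)" by auto
    then have "ks @ [Suc k] \<in> increasing_tuples (Suc p)"
      by (simp add: snoc_mem_increasing_tuples)
    with x show ?case by (auto simp: bounded_tuples_def)
  next
    case (5 ks)
    then show ?case
      using increasing_tuples_Suc_last_butlast[of ks p] by (simp add: bounded_tuples_def)
  qed
  also have "\<dots> = (\<Sum>k<n. last_sum r p m (Suc k))"
    by (simp add: last_sum_def sum.Sigma finite_bounded_tuples)
  finally show ?thesis .
qed

lemma last_sum_mult:
  assumes "N > 0"
  shows "real (N + r) * last_sum r p m N =
    (if m = 0 then 0 else last_sum r p (m - 1) N) + head_sum r p m N"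
  unfolding last_sum_def head_sum_def sum_distrib_left tuple_sum_snoc_mult[OF assms]
  by (simp add: sum.distrib)

subsection \<open>The generating function in the depth\<close>

text \<open>The coefficient of \<open>x^b\<close> in \<open>(1 - x)^(-y)\<close>.\<close>

definition beta_coeff :: "real \<Rightarrow> nat \<Rightarrow> real" where
  "beta_coeff y b = pochhammer y b / fact b"

lemma beta_coeff_0 [simp]: "beta_coeff y 0 = 1"
  by (simp add: beta_coeff_def)

lemma beta_coeff_Suc: "real (Suc b) * beta_coeff y (Suc b) = (y + real b) * beta_coeff y b"
  by (simp add: beta_coeff_def pochhammer_rec' fact_Suc del: of_nat_Suc)

lemma beta_coeff_pos: "0 < y \<Longrightarrow> 0 < beta_coeff y b"
  by (simp add: beta_coeff_def pochhammer_pos)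

lemma sum_beta_coeff: "y * (\<Sum>b<n. beta_coeff y b) = real n * beta_coeff y n"
proof (induction n)
  case (Suc n)
  then show ?case using beta_coeff_Suc[of n y] by (simp add: algebra_simps)
qed simp

definition beta_conv :: "nat \<Rightarrow> real \<Rightarrow> nat \<Rightarrow> nat \<Rightarrow> real" where
  "beta_conv r y s n =
     (\<Sum>l\<le>n. beta_coeff (1 - y) l * beta_coeff y (n - l) / real (Suc l + r) ^ s)"

text \<open>Vandermonde's convolution: \<open>(1 - x)^(y - 1)\<close> times
  \<open>(1 - x)^(-y)\<close> is \<open>1 / (1 - x)\<close>.\<close>

lemma beta_conv_0: "beta_conv r y 0 n = 1"
proof -
  have "beta_conv r y 0 n * fact n =
     (\<Sum>l\<le>n. real (n choose l) * pochhammer (1 - y) l * pochhammer y (n - l))"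
    unfolding beta_conv_def sum_distrib_right
    by (intro sum.cong) (auto simp: beta_coeff_def binomial_fact)
  also have "\<dots> = pochhammer (1 - y + y) n"
    by (subst pochhammer_binomial_sum) simp
  also have "\<dots> = fact n" by (simp add: pochhammer_fact)
  finally show ?thesis by simp
qed

text \<open>Write \<open>n + 1 + r = (l + 1 + r) + (n - l)\<close>. The first part cancels a
  denominator; the second becomes a partial sum by \<open>sum_beta_coeff\<close>, regrouped by
  \<open>k = l + b\<close>.\<close>

lemma beta_conv_Suc:
  "real (Suc n + r) * beta_conv r y (Suc s) n =
     beta_conv r y s n + y * (\<Sum>k<n. beta_conv r y (Suc s) k)"
proof -
  let ?A = "\<lambda>l. beta_coeff (1 - y) l / real (Suc l + r) ^ Suc s"
  have "real (Suc n + r) * beta_conv r y (Suc s) n =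
     (\<Sum>l\<le>n. (real (Suc l + r) + real (n - l)) * (?A l * beta_coeff y (n - l)))"
    unfolding beta_conv_def sum_distrib_left
    by (intro sum.cong) (auto simp: mult.assoc simp flip: of_nat_add)
  also have "\<dots> = (\<Sum>l\<le>n. real (Suc l + r) * (?A l * beta_coeff y (n - l))) +
     (\<Sum>l\<le>n. ?A l * (real (n - l) * beta_coeff y (n - l)))"
    unfolding sum.distrib[symmetric] by (intro sum.cong refl) algebra
  also have "(\<Sum>l\<le>n. real (Suc l + r) * (?A l * beta_coeff y (n - l))) = beta_conv r y s n"
    unfolding beta_conv_def by (intro sum.cong) (auto simp del: of_nat_Suc of_nat_add)
  also have "(\<Sum>l\<le>n. ?A l * (real (n - l) * beta_coeff y (n - l))) =
     y * (\<Sum>l\<le>n. \<Sum>b<n - l. ?A l * beta_coeff y b)"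
    unfolding sum_beta_coeff[symmetric] sum_distrib_left by (intro sum.cong refl mult.left_commute)
  also have "(\<Sum>l\<le>n. \<Sum>b<n - l. ?A l * beta_coeff y b) =
     (\<Sum>(l, b)\<in>{(l, b). l + b < n}. ?A l * beta_coeff y b)"
  proof -
    have "{(l, b). l + b < n} = Sigma {..n} (\<lambda>l. {..<n - l})" by auto
    then show ?thesis by (simp add: sum.Sigma)
  qed
  also have "\<dots> = (\<Sum>k<n. beta_conv r y (Suc s) k)"
    by (simp add: sum.triangle_reindex beta_conv_def)
  finally show ?thesis .
qed

text \<open>\<open>last_sum_mult\<close> with \<open>head_sum_Suc\<close> matches
  \<open>beta_conv_Suc\<close>: strong induction on \<open>n\<close>, and inside it induction on
  \<open>m\<close>.\<close>

lemma last_sum_sums: "(\<lambda>p. y ^ p * last_sum r p m (Suc n)) sums beta_conv r y (Suc m) n"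
proof (induction n arbitrary: m rule: less_induct)
  case (less n)
  let ?N = "real (Suc n + r)"
  \<comment> \<open>Depth \<open>p = 0\<close> falls outside \<open>head_sum_Suc\<close> and
    contributes the indicator of \<open>m = 0\<close>.\<close>
  have head: "(\<lambda>p. y ^ p * head_sum r p m (Suc n)) sums
      (y * (\<Sum>k<n. beta_conv r y (Suc m) k) + (if m = 0 then 1 else 0))" for m
  proof -
    have "(\<lambda>p. y * (\<Sum>k<n. y ^ p * last_sum r p m (Suc k))) sums
        (y * (\<Sum>k<n. beta_conv r y (Suc m) k))"
      by (intro sums_mult sums_sum less.IH) auto
    then have "(\<lambda>p. y ^ Suc p * head_sum r (Suc p) m (Suc n)) sums
        (y * (\<Sum>k<n. beta_conv r y (Suc m) k))"
      by (simp add: head_sum_Suc sum_distrib_left mult_ac)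
    from sums_Suc[OF this] show ?thesis by (simp add: head_sum_0)
  qed
  \<comment> \<open>The indicator makes the premise uniform in \<open>m\<close>: for
    \<open>m = 0\<close> it reads that the zero series sums to
    \<open>beta_conv r y 0 n - 1 = 0\<close>.\<close>
  have step: "(\<lambda>p. y ^ p * last_sum r p m (Suc n)) sums beta_conv r y (Suc m) n"
    if "(\<lambda>p. y ^ p * (if m = 0 then 0 else last_sum r p (m - 1) (Suc n))) sums
          (beta_conv r y m n - (if m = 0 then 1 else 0))" for m
  proof -
    have "(\<lambda>p. (y ^ p * (if m = 0 then 0 else last_sum r p (m - 1) (Suc n)) +
               y ^ p * head_sum r p m (Suc n)) / ?N) sums
          ((beta_conv r y m n - (if m = 0 then 1 else 0) +
           (y * (\<Sum>k<n. beta_conv r y (Suc m) k) + (if m = 0 then 1 else 0))) / ?N)"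
      by (intro sums_divide sums_add that head)
    also have "(\<lambda>p. (y ^ p * (if m = 0 then 0 else last_sum r p (m - 1) (Suc n)) +
               y ^ p * head_sum r p m (Suc n)) / ?N) = (\<lambda>p. y ^ p * last_sum r p m (Suc n))"
      unfolding distrib_left[symmetric] last_sum_mult[OF zero_less_Suc, symmetric]
      by simp
    also have "(beta_conv r y m n - (if m = 0 then 1 else 0) +
           (y * (\<Sum>k<n. beta_conv r y (Suc m) k) + (if m = 0 then 1 else 0))) / ?N =
           ?N * beta_conv r y (Suc m) n / ?N"
      unfolding beta_conv_Suc by simp
    also have "\<dots> = beta_conv r y (Suc m) n" by simp
    finally show ?thesis .
  qed
  show ?case
  proof (induction m)
    case 0
    show ?case by (rule step) (simp add: beta_conv_0)
  next
    case (Suc m)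
    show ?case by (rule step) (use Suc in simp)
  qed
qed

section \<open>The Beta series\<close>

text \<open>The growth is that of \<open>n^(y - 1) / Gamma(y)\<close>, read off from the product for
  the reciprocal Gamma function.\<close>

lemma beta_coeff_tendsto_0:
  assumes "0 < y" "y < 1"
  shows "beta_coeff y \<longlonglongrightarrow> 0"
proof (rule tendsto_sandwich)
  show "\<forall>\<^sub>F n in sequentially. 0 \<le> beta_coeff y n"
    using beta_coeff_pos[OF assms(1)] by (simp add: less_imp_le)
  show "\<forall>\<^sub>F n in sequentially. beta_coeff y n \<le> rGamma_series y n * real n powr (y - 1)"
    using eventually_gt_at_top[of 0]
  proof eventually_elim
    case (elim n)
    have "beta_coeff y n * real n \<le> beta_coeff y n * (y + real n)"
      using assms beta_coeff_pos[OF assms(1), of n] by simp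
    also have "\<dots> = rGamma_series y n * real n powr y"
      using elim by (simp add: rGamma_series_def beta_coeff_def pochhammer_rec' powr_def)
    finally show ?case
      using elim by (simp add: powr_diff field_simps)
  qed
  have "(\<lambda>n. real n powr (y - 1)) \<longlonglongrightarrow> 0"
    using assms by (intro tendsto_neg_powr filterlim_real_sequentially) simp
  from tendsto_mult[OF rGamma_series_LIMSEQ this]
  show "(\<lambda>n. rGamma_series y n * real n powr (y - 1)) \<longlonglongrightarrow> 0" by simp
qed simp

text \<open>The value is the Beta integral of \<open>x^q (1 - x)^(-y)\<close> over
  \<open>[0, 1]\<close>; the proof telescopes, by induction on \<open>q\<close>.\<close>

lemma beta_coeff_series:
  assumes "0 < y" "y < 1"
  shows "(\<lambda>b. beta_coeff y b / real (b + Suc q)) sums (fact q / pochhammer (1 - y) (Suc q))"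
proof (induction q)
  case 0
  have eq: "(beta_coeff y b - beta_coeff y (Suc b)) / (1 - y) = beta_coeff y b / real (b + Suc 0)" for b
    using beta_coeff_Suc[of b y] assms by (simp add: field_simps)
  from sums_divide[OF telescope_sums'[OF beta_coeff_tendsto_0[OF assms]], of "1 - y"]
  show ?case unfolding eq by simp
next
  case (Suc q)
  \<comment> \<open>\<open>U\<close> is chosen so that \<open>q + 1\<close> times the summand for
    \<open>q\<close>, minus the increment of \<open>U\<close>, is \<open>q + 2 - y\<close> times the
    summand for \<open>q + 1\<close>. As \<open>U 0 = 0\<close> and \<open>U\<close> tends to 0, the
    increments sum to 0.\<close>
  define U where "U b = real b * beta_coeff y b / real (b + Suc q)" for b
  have "U \<longlonglongrightarrow> 0"
  proof (rule tendsto_sandwich[OF _ _ tendsto_const beta_coeff_tendsto_0[OF assms]])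
    show "\<forall>\<^sub>F n in sequentially. 0 \<le> U n" "\<forall>\<^sub>F n in sequentially. U n \<le> beta_coeff y n"
      using less_imp_le[OF beta_coeff_pos[OF assms(1)]]
      by (auto simp: U_def divide_le_eq mult_right_mono algebra_simps intro!: always_eventually)
  qed
  from telescope_sums[OF this] have U: "(\<lambda>b. U (Suc b) - U b) sums 0"
    by (simp add: U_def)
  have eq: "(real (Suc q) * (beta_coeff y b / real (b + Suc q)) - (U (Suc b) - U b)) /
       (real (Suc (Suc q)) - y) = beta_coeff y b / real (b + Suc (Suc q))" for b
  proof -
    define c u where "c = beta_coeff y b" and "u = real (b + Suc q)"
    have u: "u > 0" "real (b + Suc (Suc q)) = u + 1" "real (Suc q) = u - real b"
      by (auto simp: u_def)
    have "U (Suc b) = (y + real b) * c / (u + 1)"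
      unfolding U_def beta_coeff_Suc c_def using u(2) by simp
    moreover have "real (Suc q) * (c / u) + U b = c"
      using u(1) unfolding U_def u(3) c_def u_def[symmetric] by (simp add: field_simps)
    ultimately have "real (Suc q) * (c / u) - (U (Suc b) - U b) = c - (y + real b) * c / (u + 1)"
      by simp
    also have "\<dots> = (real (Suc (Suc q)) - y) * (c / (u + 1))"
      using u(1) unfolding of_nat_Suc[of "Suc q"] u(3) by (simp add: field_simps)
    finally show ?thesis
      using assms unfolding u(2) c_def[symmetric] u_def[symmetric] by simp
  qed
  have "real (Suc q) * (fact q / pochhammer (1 - y) (Suc q)) / (real (Suc (Suc q)) - y) =
      fact (Suc q) / pochhammer (1 - y) (Suc (Suc q))"
    by (subst (2) pochhammer_rec') (simp add: mult_ac)
  with sums_divide[OF sums_diff[OF sums_mult[OF Suc.IH, of "real (Suc q)"] U],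
      of "real (Suc (Suc q)) - y"]
  show ?case unfolding eq by simp
qed

subsection \<open>Finite differences of negative powers\<close>

text \<open>This is \<open>(1 - E)^r\<close> applied to \<open>z^(-p)\<close>, with \<open>E\<close>
  the shift by 1 in \<open>z\<close>.\<close>

definition alt_binomial_sum :: "nat \<Rightarrow> nat \<Rightarrow> real \<Rightarrow> real" where
  "alt_binomial_sum r p z = (\<Sum>j\<le>r. (- 1) ^ j * real (r choose j) / (z + real j) ^ p)"

text \<open>Write \<open>z + r = (z + j) + (r - j)\<close>: the first part lowers the power, the
  second is absorbed into the binomial coefficient. For \<open>r = 0\<close> the truncated
  \<open>r - 1\<close> is harmless, since its factor is 0.\<close>

lemma alt_binomial_sum_rec:
  assumes "0 < z"
  shows "(z + real r) * alt_binomial_sum r (Suc p) z =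
    alt_binomial_sum r p z + real r * alt_binomial_sum (r - 1) (Suc p) z"
proof -
  let ?t = "\<lambda>r p j. (- 1) ^ j * real (r choose j) / (z + real j) ^ p"
  have "(z + real r) * alt_binomial_sum r (Suc p) z =
      (\<Sum>j\<le>r. ?t r p j + real (r - j) * ?t r (Suc p) j)"
    unfolding alt_binomial_sum_def sum_distrib_left
  proof (intro sum.cong refl)
    fix j assume "j \<in> {..r}"
    then have "z + real r = (z + real j) + real (r - j)" by simp
    then have "(z + real r) * ?t r (Suc p) j = (z + real j) * ?t r (Suc p) j + real (r - j) * ?t r (Suc p) j"
      by (simp only: distrib_right)
    also have "(z + real j) * ?t r (Suc p) j = ?t r p j" using assms by simp
    finally show "(z + real r) * ?t r (Suc p) j = ?t r p j + real (r - j) * ?t r (Suc p) j" .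
  qed
  also have "\<dots> = alt_binomial_sum r p z + (\<Sum>j\<le>r. real (r - j) * ?t r (Suc p) j)"
    by (simp add: sum.distrib alt_binomial_sum_def)
  also have "(\<Sum>j\<le>r. real (r - j) * ?t r (Suc p) j) = real r * alt_binomial_sum (r - 1) (Suc p) z"
  proof (cases r)
    case (Suc r')
    have "real (Suc r' - j) * real (Suc r' choose j) = real (Suc r') * real (r' choose j)"
      if "j \<le> r'" for j
      using binomial_absorb_comp[of "Suc r'" j] by (metis diff_Suc_1 of_nat_mult)
    then show ?thesis
      unfolding Suc alt_binomial_sum_def sum_distrib_left
      by (auto simp: mult_ac intro!: sum.cong)
  qed simp
  finally show ?thesis .
qed

text \<open>The recursion has nonnegative coefficients. This sign is what permits exchanging sums on
  the right-hand side.\<close>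

lemma alt_binomial_sum_nonneg:
  assumes "0 < z"
  shows "0 \<le> alt_binomial_sum r p z"
proof (induction p arbitrary: r)
  case 0
  show ?case
    using choose_alternating_sum[of r, where 'a = real]
    by (cases "r = 0") (simp_all add: alt_binomial_sum_def)
next
  case (Suc p)
  show ?case
  proof (induction r)
    case 0
    show ?case using assms by (simp add: alt_binomial_sum_def)
  next
    case (Suc r)
    have "0 \<le> (z + real (Suc r)) * alt_binomial_sum (Suc r) (Suc p) z"
      unfolding alt_binomial_sum_rec[OF assms] using Suc \<open>\<And>r. 0 \<le> alt_binomial_sum r p z\<close> by simp
    then show ?case using assms by (simp add: zero_le_mult_iff)
  qed
qed

text \<open>A partial fraction expansion: for positive \<open>r\<close> the power-0 term of the
  recursion is \<open>(1 - 1)^r = 0\<close>, leaving a product.\<close>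

lemma alt_binomial_sum_1:
  assumes "0 < z"
  shows "alt_binomial_sum r 1 z = fact r / pochhammer z (Suc r)"
proof (induction r)
  case 0
  show ?case by (simp add: alt_binomial_sum_def)
next
  case (Suc r)
  have "alt_binomial_sum (Suc r) 0 z = 0"
    using choose_alternating_sum[of "Suc r", where 'a = real] by (simp add: alt_binomial_sum_def del: sum.atMost_Suc)
  with alt_binomial_sum_rec[OF assms, of "Suc r" 0] Suc.IH
  have "(z + real (Suc r)) * alt_binomial_sum (Suc r) 1 z = fact (Suc r) / pochhammer z (Suc r)"
    by simp
  then have "alt_binomial_sum (Suc r) 1 z = fact (Suc r) / pochhammer z (Suc r) / (z + real (Suc r))"
    using assms
    by (metis add_pos_nonneg less_irrefl nonzero_mult_div_cancel_left of_nat_0_le_iff)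
  then show ?case
    by (subst pochhammer_rec') (simp add: mult.commute del: of_nat_Suc fact_Suc)
qed

text \<open>Geometric series turn each \<open>1 / (z + j)\<close> into
  \<open>1 / (z - y + j)\<close>, giving the partial fractions at \<open>z - y\<close>.\<close>

lemma alt_binomial_sum_sums:
  assumes "1 \<le> z" "0 \<le> y" "y < 1"
  shows "(\<lambda>q. y ^ q * alt_binomial_sum r (Suc q) z) sums (fact r / pochhammer (z - y) (Suc r))"
proof -
  have eq: "c / u * (1 / (1 - y / u)) = c / (u - y)" if "u \<noteq> 0" for c u :: real
  proof -
    have "u * (1 - y / u) = u - y" using that by (simp add: right_diff_distrib)
    moreover have "c / u * (1 / (1 - y / u)) = c / (u * (1 - y / u))" by simp
    ultimately show ?thesis by simp
  qed
  have "(\<lambda>q. \<Sum>j\<le>r. (- 1) ^ j * real (r choose j) / (z + real j) * (y / (z + real j)) ^ q) sums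
      (\<Sum>j\<le>r. (- 1) ^ j * real (r choose j) / (z + real j) * (1 / (1 - y / (z + real j))))"
    using assms by (intro sums_sum sums_mult geometric_sums) auto
  also have "(\<Sum>j\<le>r. (- 1) ^ j * real (r choose j) / (z + real j) * (1 / (1 - y / (z + real j)))) =
      alt_binomial_sum r 1 (z - y)"
    unfolding alt_binomial_sum_def using assms
    by (intro sum.cong refl, subst eq) (auto simp: algebra_simps)
  also have "\<dots> = fact r / pochhammer (z - y) (Suc r)"
    using assms by (intro alt_binomial_sum_1) simp
  finally show ?thesis
    by (simp add: alt_binomial_sum_def sum_distrib_left power_divide mult_ac)
qed

subsection \<open>Comparison of the generating functions\<close>

text \<open>The Beta series at \<open>q = l + r\<close>; splitting \<open>(1 - y)_(l+r+1)\<close>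
  and \<open>(l + r)!\<close> after \<open>l\<close> factors cancels
  \<open>beta_coeff (1 - y) l\<close>.\<close>

lemma beta_row_sums:
  assumes "0 < y" "y < 1"
  shows "(\<lambda>b. beta_coeff (1 - y) l * beta_coeff y b / (real (Suc l + r) ^ Suc m * real (Suc (l + b) + r)))
    sums (pochhammer (real (Suc l)) r / real (Suc l + r) ^ Suc m / pochhammer (real (Suc l) - y) (Suc r))"
proof -
  have "pochhammer (1 - y) (l + Suc r) = pochhammer (1 - y) l * pochhammer (real (Suc l) - y) (Suc r)"
    by (subst pochhammer_product') (simp add: algebra_simps)
  moreover have "fact (l + r) = fact l * pochhammer (real (Suc l)) r"
    using pochhammer_product'[of "1 :: real" l r] by (simp add: pochhammer_fact[symmetric])
  moreover have "pochhammer (1 - y) l \<noteq> 0"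
    using assms pochhammer_pos[of "1 - y" l] by simp
  ultimately have "beta_coeff (1 - y) l / real (Suc l + r) ^ Suc m * (fact (l + r) / pochhammer (1 - y) (Suc (l + r))) =
      pochhammer (real (Suc l)) r / real (Suc l + r) ^ Suc m / pochhammer (real (Suc l) - y) (Suc r)"
    by (simp add: beta_coeff_def del: of_nat_Suc of_nat_add power_Suc)
  moreover have "beta_coeff (1 - y) l / real (Suc l + r) ^ Suc m * (beta_coeff y b / real (b + Suc (l + r))) =
      beta_coeff (1 - y) l * beta_coeff y b / (real (Suc l + r) ^ Suc m * real (Suc (l + b) + r))" for b
    by (simp add: add_ac del: of_nat_Suc of_nat_add power_Suc)
  ultimately show ?thesis
    using sums_mult[OF beta_coeff_series[OF assms, of "l + r"], of "beta_coeff (1 - y) l / real (Suc l + r) ^ Suc m"]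
    by (simp only:)
qed

lemma beta_total_summable:
  assumes "0 < y" "y < 1"
  shows "summable (\<lambda>l. pochhammer (real (Suc l)) r / real (Suc l + r) ^ Suc m / pochhammer (real (Suc l) - y) (Suc r))"
    (is "summable ?f")
proof (rule summable_comparison_test')
  show "summable (\<lambda>l. 1 / (1 - y) * (1 / real (Suc l) ^ 2))"
    by (intro summable_mult) (use inverse_power_summable[of 2, where 'a = real] in
        \<open>simp add: summable_Suc_iff[of "\<lambda>n. 1 / real n ^ 2"] inverse_eq_divide del: of_nat_Suc\<close>)
  fix l :: nat
  define z where "z = real (Suc l)"
  have z: "1 \<le> z" by (simp add: z_def)
  have p: "0 < pochhammer z r" using z by (intro pochhammer_pos) simp
  \<comment> \<open>Since \<open>y < 1\<close>, each factor grows; the bounds then compare the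
    series with \<open>1 / ((1 - y) z^2)\<close>.\<close>
  have "pochhammer z r \<le> pochhammer (z - y + 1) r"
    unfolding pochhammer_prod using assms z by (intro prod_mono) auto
  then have "(z - y) * pochhammer z r \<le> pochhammer (z - y) (Suc r)"
    unfolding pochhammer_rec using assms z by (intro mult_left_mono) auto
  moreover have "z * (1 - y) \<le> z - y" using assms z by (simp add: algebra_simps)
  then have "z * (1 - y) * pochhammer z r \<le> (z - y) * pochhammer z r"
    using p by (intro mult_right_mono) auto
  ultimately have le: "z * (1 - y) * pochhammer z r \<le> pochhammer (z - y) (Suc r)" by linarith
  have pos: "0 < z * (1 - y) * pochhammer z r" using p z assms by simp
  have "z ^ 1 \<le> (z + real r) ^ 1" by simp
  also have "\<dots> \<le> (z + real r) ^ Suc m" using z by (intro power_increasing) auto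
  finally have le2: "z \<le> (z + real r) ^ Suc m" by simp
  have "norm (?f l) = pochhammer z r / (z + real r) ^ Suc m / pochhammer (z - y) (Suc r)"
    using p pos le z by (simp add: z_def add_ac del: power_Suc)
  also have "\<dots> \<le> pochhammer z r / z / (z * (1 - y) * pochhammer z r)"
    using le le2 pos p z by (intro frac_le divide_left_mono) auto
  also have "\<dots> = 1 / (1 - y) * (1 / z ^ 2)"
    using p by (simp add: power2_eq_square)
  finally show "norm (?f l) \<le> 1 / (1 - y) * (1 / real (Suc l) ^ 2)" by (simp add: z_def)
qed

text \<open>The common value of both sides after weighting depth \<open>q + 1\<close> by
  \<open>y^q\<close> and summing over \<open>q\<close>.\<close>

definition gen_fun :: "nat \<Rightarrow> nat \<Rightarrow> real \<Rightarrow> real" where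
  "gen_fun r m y =
     (\<Sum>l. pochhammer (real (Suc l)) r / real (Suc l + r) ^ Suc m / pochhammer (real (Suc l) - y) (Suc r))"

lemma gen_fun_has_sum:
  assumes "0 < y" "y < 1"
  shows "((\<lambda>l. pochhammer (real (Suc l)) r / real (Suc l + r) ^ Suc m / pochhammer (real (Suc l) - y) (Suc r))
    has_sum gen_fun r m y) UNIV"
  unfolding gen_fun_def using assms
  by (intro sums_nonneg_imp_has_sum summable_sums beta_total_summable
      divide_nonneg_nonneg pochhammer_nonneg zero_le_power) auto

lemma beta_conv_has_sum:
  assumes y: "0 < y" "y < 1"
  shows "((\<lambda>n. beta_conv r y (Suc m) n / real (Suc n + r)) has_sum gen_fun r m y) UNIV"
proof -
  define f where "f = (\<lambda>(l, b). beta_coeff (1 - y) l * beta_coeff y b /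
     (real (Suc l + r) ^ Suc m * real (Suc (l + b) + r)))"
  have nonneg: "0 \<le> f x" for x
    using beta_coeff_pos[of y] beta_coeff_pos[of "1 - y"] y
    by (auto simp: f_def less_imp_le split: prod.split intro!: divide_nonneg_nonneg mult_nonneg_nonneg)
  have row: "((\<lambda>b. f (l, b)) has_sum (pochhammer (real (Suc l)) r / real (Suc l + r) ^ Suc m /
      pochhammer (real (Suc l) - y) (Suc r))) UNIV" for l
    using beta_row_sums[OF y, of l r m] nonneg[of "(l, _)"]
    by (intro sums_nonneg_imp_has_sum) (simp_all add: f_def)
  have "f summable_on UNIV \<times> UNIV"
    by (rule summable_on_SigmaI[OF row has_sum_imp_summable[OF gen_fun_has_sum[OF y]] nonneg])
  then have "(f has_sum gen_fun r m y) (UNIV \<times> UNIV)"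
    by (intro has_sum_SigmaI[OF row gen_fun_has_sum[OF y]])
  \<comment> \<open>Regroup along the antidiagonals \<open>n = l + b\<close>.\<close>
  also have "(f has_sum gen_fun r m y) (UNIV \<times> UNIV) \<longleftrightarrow>
      ((\<lambda>(n, l). f (l, n - l)) has_sum gen_fun r m y) (Sigma UNIV (\<lambda>n. {..n}))"
    by (rule has_sum_reindex_bij_witness[where j = "\<lambda>(l, b). (l + b, l)" and i = "\<lambda>(n, l). (l, n - l)"])
      auto
  finally have "((\<lambda>(n, l). f (l, n - l)) has_sum gen_fun r m y) (Sigma UNIV (\<lambda>n. {..n}))" .
  then show ?thesis
  proof (rule has_sum_SigmaD)
    fix n
    show "((\<lambda>l. case (n, l) of (n, l) \<Rightarrow> f (l, n - l)) has_sum
        (beta_conv r y (Suc m) n / real (Suc n + r))) {..n}"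
      unfolding beta_conv_def sum_divide_distrib
      by (intro has_sum_finiteI) (auto simp: f_def intro!: sum.cong)
  qed
qed

text \<open>Exchange the sums over the last entry and over the depth; dividing out
  \<open>y^q\<close> then frees summability from \<open>y\<close>.\<close>

lemma last_sum_gen_fun:
  assumes y: "0 < y" "y < 1"
  shows "(\<lambda>n. last_sum r q m (Suc n) / real (Suc n + r)) summable_on UNIV" (is ?A)
    and "(\<lambda>q. y ^ q * (\<Sum>\<^sub>\<infinity>n. last_sum r q m (Suc n) / real (Suc n + r))) sums gen_fun r m y" (is ?B)
proof -
  let ?f = "\<lambda>n q. y ^ q * (last_sum r q m (Suc n) / real (Suc n + r))"
  have nonneg: "0 \<le> ?f n q" for n q
    using y by (intro mult_nonneg_nonneg divide_nonneg_nonneg last_sum_nonneg) auto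
  have row: "(?f n has_sum beta_conv r y (Suc m) n / real (Suc n + r)) UNIV" for n
    using sums_divide[OF last_sum_sums[of y r m n], of "real (Suc n + r)"] nonneg
    by (intro sums_nonneg_imp_has_sum) auto
  note * = has_sum_swap_nonneg[of ?f, OF nonneg row beta_conv_has_sum[OF y]]
  have "y ^ q \<noteq> 0" using y by simp
  with *(1)[OF UNIV_I, of q] show ?A by (simp only: summable_on_cmult_right' not_False_eq_True)
  show ?B using has_sum_imp_sums[OF *(2)] by (simp only: infsum_cmult_right')
qed

lemma rhs_term_alt:
  "rhs_term p m r l = pochhammer (real l) r / real (l + r) ^ Suc m * alt_binomial_sum r p (real l)"
  by (simp add: rhs_term_def alt_binomial_sum_def atMost_atLeast0 power_int_minus divide_inverse)

lemma rhs_term_nonneg: "0 \<le> rhs_term p m r (Suc l)"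
  unfolding rhs_term_alt
  by (intro mult_nonneg_nonneg divide_nonneg_nonneg pochhammer_nonneg alt_binomial_sum_nonneg) auto

lemma rhs_gen_fun:
  assumes y: "0 < y" "y < 1"
  shows "(\<lambda>l. rhs_term (Suc q) m r (Suc l)) summable_on UNIV" (is ?A)
    and "(\<lambda>q. y ^ q * ((\<Sum>\<^sub>\<infinity>l. rhs_term (Suc q) m r (Suc l)) / fact r)) sums gen_fun r m y" (is ?B)
proof -
  let ?f = "\<lambda>l q. y ^ q * (rhs_term (Suc q) m r (Suc l) * (1 / fact r))"
  have nonneg: "0 \<le> ?f n q" for n q
    using y by (intro mult_nonneg_nonneg divide_nonneg_nonneg rhs_term_nonneg) auto
  have row: "(?f l has_sum pochhammer (real (Suc l)) r / real (Suc l + r) ^ Suc m /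
      pochhammer (real (Suc l) - y) (Suc r)) UNIV" for l
    using sums_mult[OF alt_binomial_sum_sums[of "real (Suc l)" y r],
        of "pochhammer (real (Suc l)) r / real (Suc l + r) ^ Suc m / fact r"] nonneg y
    by (intro sums_nonneg_imp_has_sum) (auto simp: rhs_term_alt mult_ac simp del: of_nat_Suc of_nat_add power_Suc)
  note * = has_sum_swap_nonneg[of ?f, OF nonneg row gen_fun_has_sum[OF y]]
  have "y ^ q \<noteq> 0" "1 / fact r \<noteq> (0 :: real)" using y by simp_all
  with *(1)[OF UNIV_I, of q] show ?A
    by (simp only: summable_on_cmult_right' summable_on_cmult_left' not_False_eq_True)
  show ?B using has_sum_imp_sums[OF *(2)] by (simp only: infsum_cmult_right' infsum_cmult_left') simp
qed

text \<open>Compare the coefficients of \<open>y^q\<close> in the two expansions of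
  \<open>gen_fun\<close>.\<close>

lemma last_sum_eq_rhs:
  "(\<Sum>\<^sub>\<infinity>n. last_sum r q m (Suc n) / real (Suc n + r)) =
     (\<Sum>\<^sub>\<infinity>l. rhs_term (Suc q) m r (Suc l)) / fact r"
  using powser_unique_right[OF last_sum_gen_fun(2) rhs_gen_fun(2)] by (rule fun_cong)

section \<open>Return to the series over tuples\<close>

lemma shifted_mzv_term_nonneg: "0 \<le> shifted_mzv_term p r \<alpha> k"
  unfolding shifted_mzv_term_def by (intro mult_nonneg_nonneg prod_nonneg) auto

text \<open>The extra \<open>-1\<close> in the last exponent comes out as the division by
  \<open>n + 1 + r\<close>.\<close>

lemma shifted_mzv_term_snoc:
  assumes "length ks = q"
  shows "(\<Sum>\<alpha>\<in>weighted_tuples (Suc q) (Suc q + m). shifted_mzv_term (Suc q) r \<alpha> (ks @ [Suc n])) =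
    tuple_sum r (ks @ [Suc n]) m / real (Suc n + r)"
  unfolding tuple_sum_def sum_divide_distrib
proof (intro sum.cong)
  fix \<alpha>
  have "real (Suc n + r) powi (- int (\<alpha> ! q) - 1) = inverse (real (Suc n + r) ^ (\<alpha> ! q)) / real (Suc n + r)"
    by (subst power_int_diff) (auto simp: power_int_minus)
  then show "shifted_mzv_term (Suc q) r \<alpha> (ks @ [Suc n]) =
      (\<Prod>i<length (ks @ [Suc n]). inverse (real ((ks @ [Suc n]) ! i + r) ^ (\<alpha> ! i))) / real (Suc n + r)"
    using assms by (simp add: shifted_mzv_term_def power_int_minus nth_append del: of_nat_Suc of_nat_add)
qed (use assms in auto)

lemma tuple_series_has_sum:
  "((\<lambda>k. \<Sum>\<alpha>\<in>weighted_tuples (Suc q) (Suc q + m). shifted_mzv_term (Suc q) r \<alpha> k) has_sum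
     (\<Sum>\<^sub>\<infinity>n. last_sum r q m (Suc n) / real (Suc n + r))) (increasing_tuples (Suc q))"
proof -
  let ?h = "\<lambda>(n, ks). tuple_sum r (ks @ [Suc n]) m / real (Suc n + r)"
  let ?S = "\<Sum>\<^sub>\<infinity>n. last_sum r q m (Suc n) / real (Suc n + r)"
  have summ: "(\<lambda>n. last_sum r q m (Suc n) / real (Suc n + r)) summable_on UNIV"
    \<comment> \<open>The claim does not involve \<open>y\<close>; \<open>1 / 2\<close> is an
      arbitrary point of \<open>(0, 1)\<close>.\<close>
    by (rule last_sum_gen_fun(1)[of "1 / 2"]) auto
  have row: "((\<lambda>ks. ?h (n, ks)) has_sum last_sum r q m (Suc n) / real (Suc n + r)) (bounded_tuples q (Suc n))" for n
    unfolding last_sum_def sum_divide_distrib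
    by (intro has_sum_finiteI finite_bounded_tuples) simp
  have "?h summable_on (SIGMA n:UNIV. bounded_tuples q (Suc n))"
    by (rule summable_on_SigmaI[OF row summ]) (auto intro!: divide_nonneg_nonneg tuple_sum_nonneg)
  then have "(?h has_sum ?S) (SIGMA n:UNIV. bounded_tuples q (Suc n))"
    by (intro has_sum_SigmaI[OF row has_sum_infsum[OF summ]])
  also have "(?h has_sum ?S) (SIGMA n:UNIV. bounded_tuples q (Suc n)) \<longleftrightarrow> ?thesis"
  proof (rule has_sum_reindex_bij_witness[where
        j = "\<lambda>(n, ks). ks @ [Suc n]" and i = "\<lambda>ks. (last ks - 1, butlast ks)"], goal_cases)
    case (3 k)
    then show ?case using increasing_tuples_Suc_last_butlast[of k q] by simp
  next
    case (4 k)
    then show ?case using increasing_tuples_Suc_last_butlast[of k q] by simp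
  next
    case (5 x)
    then show ?case 
      by (auto simp: shifted_mzv_term_snoc[OF length_bounded_tuples] simp del: add_Suc of_nat_Suc of_nat_add)
  qed (auto simp: snoc_mem_increasing_tuples)
  finally show ?thesis .
qed

theorem corollary1p5:
  fixes p m r :: nat
  assumes "p \<ge> 1" and "m + p \<ge> r + 1"
  shows "(\<forall>\<alpha>\<in>weighted_tuples p (p + m).
            shifted_mzv_term p r \<alpha> summable_on increasing_tuples p) \<and>
         summable (\<lambda>n. rhs_term p m r (Suc n)) \<and>
         (\<Sum>\<alpha>\<in>weighted_tuples p (p + m).
            \<Sum>\<^sub>\<infinity>k\<in>increasing_tuples p. shifted_mzv_term p r \<alpha> k) =
         1 / fact r * (\<Sum>n. rhs_term p m r (Suc n))"
proof -
  obtain q where p: "p = Suc q" using assms(1) by (cases p) auto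
  note total = tuple_series_has_sum[where q = q and m = m and r = r, folded p]
  have rhs: "(\<lambda>n. rhs_term p m r (Suc n)) summable_on UNIV"
    unfolding p by (rule rhs_gen_fun(1)[of "1 / 2"]) auto
  \<comment> \<open>By nonnegativity each single exponent tuple is dominated by the finite sum over
    all of them.\<close>
  have lhs: "shifted_mzv_term p r \<alpha> summable_on increasing_tuples p"
    if "\<alpha> \<in> weighted_tuples p (p + m)" for \<alpha>
    by (rule summable_on_comparison_test[OF has_sum_imp_summable[OF total]])
      (use that in \<open>auto intro!: member_le_sum shifted_mzv_term_nonneg finite_weighted_tuples\<close>)
  have "(\<Sum>\<alpha>\<in>weighted_tuples p (p + m). \<Sum>\<^sub>\<infinity>k\<in>increasing_tuples p. shifted_mzv_term p r \<alpha> k) =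
      (\<Sum>\<^sub>\<infinity>k\<in>increasing_tuples p. \<Sum>\<alpha>\<in>weighted_tuples p (p + m). shifted_mzv_term p r \<alpha> k)"
    by (rule infsumI[symmetric], rule has_sum_sum) (simp_all add: lhs finite_weighted_tuples)
  also have "\<dots> = (\<Sum>\<^sub>\<infinity>l. rhs_term p m r (Suc l)) / fact r"
    using infsumI[OF total] last_sum_eq_rhs[of r q m] by (simp add: p)
  also have "(\<Sum>\<^sub>\<infinity>l. rhs_term p m r (Suc l)) = (\<Sum>l. rhs_term p m r (Suc l))"
    using has_sum_imp_sums[OF has_sum_infsum[OF rhs]] by (simp add: sums_iff)
  finally show ?thesis
    using lhs summable_on_imp_summable[OF rhs] by simp
qed

end
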